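(* Let $X$ be a time-homogeneous Markov process on a Polish space $\mathbb{X}$, $f:\mathbb{X}\to[0,\infty)$ a bounded Borel payoff function, and $\delta:\{0,1,2,\dots\}\to[0,1]$ a strictly decreasing discount function with $\delta(0)=1$ and $\lim_{k\to\infty}\delta(k)=0$. Suppose that $\delta(i)\delta(j)\le\delta(i+j)$ for all $i,j=0,1,2,\dots$. Then $$\mathbb{X}_\infty:=\bigcap_{n=1}^\infty\Theta^n(\mathbb{X})$$ is an equilibrium, i.e. $\Theta(\mathbb{X}_\infty)=\mathbb{X}_\infty$.
   Context: Setting. $\mathbb{X}$ is a Polish space with Borel $\sigma$-algebra $\mathcal{B}(\mathbb{X})$; $X=(X_t)_{t=0,1,2,\dots}$ is a time-homogeneous $\mathbb{X}$-valued Markov process with transition kernel $Q$, i.e. $\mathbb{P}(X_{t+1}\in A\mid X_t=x)=\int_A Q(x,dy)$ for all $t\ge 0$, $x\in\mathbb{X}$, $A\in\mathcal{B}(\mathbb{X})$. Write $X^x$ for the process started at $X_0=x$ and $\mathbb{E}^x$ for expectation conditional on $X_0=x$. Stopping times are with respect to the filtration generated by $X$ and may take the value $\infty$. For $x\in\mathbb{X}$ and a stopping time $\tau$, $J(x,\tau):=\mathbb{E}^x[\delta(\tau)f(X_\tau)]$, where $\delta(\tau)f(X_\tau):=0$ on $\{\tau=\infty\}$. For $S\in\mathcal{B}(\mathbb{X})$, $\rho(x,S):=\inf\{t\ge 1: X^x_t\in S\}$ (with $\inf\emptyset=\infty$), and $$\Theta(S):=\{x\in\mathbb{X}: f(x)\ge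 J(x,\rho(x,S))\}\in\mathcal{B}(\mathbb{X}).$$ $\Theta^n$ is the $n$-fold composition of $\Theta$. A set $S\in\mathcal{B}(\mathbb{X})$ is called an equilibrium if $\Theta(S)=S$. *)

theory Defs
  imports "HOL-Probability.Probability"
begin

definition natural_filtration ::
    "'w measure \<Rightarrow> (nat \<Rightarrow> 'w \<Rightarrow> 'a::topological_space) \<Rightarrow> nat \<Rightarrow> 'w measure" where
  "natural_filtration M X t =
     sigma (space M) {X s -` A \<inter> space M | s A. s \<le> t \<and> A \<in> sets borel}"

definition markov_process ::
    "('a::topological_space \<Rightarrow> 'a measure) \<Rightarrow> 'w measure \<Rightarrow> (nat \<Rightarrow> 'w \<Rightarrow> 'a) \<Rightarrow> bool" where
  "markov_process Q M X \<longleftrightarrow>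
     Q \<in> borel \<rightarrow>\<^sub>M prob_algebra borel \<and>
     prob_space M \<and>
     (\<forall>t. X t \<in> M \<rightarrow>\<^sub>M borel) \<and>
     (\<forall>t. \<forall>A\<in>sets borel. AE \<omega> in M.
        real_cond_exp M (natural_filtration M X t) (\<lambda>\<omega>. indicator A (X (Suc t) \<omega>)) \<omega>
          = measure (Q (X t \<omega>)) A)"

(* M x and X x are the probability space and the process X^x started at x. The processes may live
   on different spaces; they are tied together only by the common kernel Q. *)
definition markov_family ::
    "('a::topological_space \<Rightarrow> 'a measure) \<Rightarrow> ('a \<Rightarrow> 'w measure) \<Rightarrow> ('a \<Rightarrow> nat \<Rightarrow> 'w \<Rightarrow> 'a) \<Rightarrow> bool" where
  "markov_family Q M X \<longleftrightarrow>
     (\<forall>x. markov_process Q (M x) (X x) \<and> (AE \<omega> in M x. X x 0 \<omega> = x))"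

definition expected_payoff ::
    "('a \<Rightarrow> 'w measure) \<Rightarrow> ('a \<Rightarrow> nat \<Rightarrow> 'w \<Rightarrow> 'a) \<Rightarrow> (nat \<Rightarrow> real) \<Rightarrow> ('a \<Rightarrow> real) \<Rightarrow>
     'a \<Rightarrow> ('w \<Rightarrow> enat) \<Rightarrow> real" where
  "expected_payoff M X \<delta> f x \<tau> =
     (LINT \<omega>|M x. (case \<tau> \<omega> of enat t \<Rightarrow> \<delta> t * f (X x t \<omega>) | \<infinity> \<Rightarrow> 0))"

(* The infimum is taken in enat, where Inf {} = \<infinity>. *)
definition return_time ::
    "('a \<Rightarrow> nat \<Rightarrow> 'w \<Rightarrow> 'a) \<Rightarrow> 'a \<Rightarrow> 'a set \<Rightarrow> 'w \<Rightarrow> enat" where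
  "return_time X x S \<omega> = Inf {enat t | t. 1 \<le> t \<and> X x t \<omega> \<in> S}"

definition Theta ::
    "('a \<Rightarrow> 'w measure) \<Rightarrow> ('a \<Rightarrow> nat \<Rightarrow> 'w \<Rightarrow> 'a) \<Rightarrow> (nat \<Rightarrow> real) \<Rightarrow> ('a \<Rightarrow> real) \<Rightarrow>
     'a set \<Rightarrow> 'a set" where
  "Theta M X \<delta> f S = {x. f x \<ge> expected_payoff M X \<delta> f x (return_time X x S)}"

definition equilibrium ::
    "('a::topological_space \<Rightarrow> 'w measure) \<Rightarrow> ('a \<Rightarrow> nat \<Rightarrow> 'w \<Rightarrow> 'a) \<Rightarrow> (nat \<Rightarrow> real) \<Rightarrow>
     ('a \<Rightarrow> real) \<Rightarrow> 'a set \<Rightarrow> bool" where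
  "equilibrium M X \<delta> f S \<longleftrightarrow> S \<in> sets borel \<and> Theta M X \<delta> f S = S"

end

theory Submission
  imports Defs
begin

text \<open>
  The payoff from waiting until \<open>S\<close> is hit, evaluated with the clock already showing \<open>s\<close>,
  satisfies a one-step recursion in \<open>(s, x)\<close> under the kernel \<open>Q\<close>, and is at most a constant
  times \<open>\<delta> s\<close>.  As \<open>\<delta>\<close> tends to 0, iterating the recursion compares sub- and supersolutions.
  At a point of \<open>S - \<Theta> S\<close> waiting beats stopping when the clock shows 0, and by
  \<open>\<delta> i * \<delta> j \<le> \<delta> (i + j)\<close> it does so at every clock time; hence the value for \<open>S\<close> is a
  subsolution of the recursion for \<open>\<Theta> S\<close>, provided that \<open>\<Theta> S \<subseteq> S\<close>.  So the values along
  \<open>\<Theta>^n UNIV\<close> increase while the sets decrease, the limit of the values solves the recursion for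
  the intersection, and it is therefore the value for the intersection.
\<close>

section \<open>Operators of the transition kernel\<close>

text \<open>\<open>step Q A\<close> is the transition operator of the process killed when it lands
  outside \<open>A\<close>. Only the landing point is tested, never the starting point, in line with
  return times that count from time 1.\<close>

definition step :: "('a \<Rightarrow> 'a measure) \<Rightarrow> 'a set \<Rightarrow> ('a \<Rightarrow> ennreal) \<Rightarrow> 'a \<Rightarrow> ennreal" where
  "step Q A h x = (\<integral>\<^sup>+y\<in>A. h y \<partial>Q x)"

text \<open>The summand for \<open>t\<close> is the contribution of first hitting \<open>S\<close> after \<open>t + 1\<close> steps.\<close>

definition hit_value ::
    "('a \<Rightarrow> 'a measure) \<Rightarrow> (nat \<Rightarrow> real) \<Rightarrow> ('a \<Rightarrow> real) \<Rightarrow> 'a set \<Rightarrow> nat \<Rightarrow> 'a \<Rightarrow> ennreal" where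
  "hit_value Q \<delta> f S s x =
     (\<Sum>t. ennreal (\<delta> (s + t + 1)) * (step Q (- S) ^^ t) (step Q S (\<lambda>y. ennreal (f y))) x)"

locale kernel =
  fixes Q :: "'a::topological_space \<Rightarrow> 'a measure"
  assumes Q_measurable: "Q \<in> borel \<rightarrow>\<^sub>M prob_algebra borel"
begin

lemma sets_Q [measurable_cong, simp]: "sets (Q x) = sets borel"
  using measurable_space[OF Q_measurable, of x] by (simp add: space_prob_algebra)

lemma space_Q [simp]: "space (Q x) = UNIV"
  using sets_eq_imp_space_eq[OF sets_Q] by simp

lemma prob_space_Q: "prob_space (Q x)"
  using measurable_space[OF Q_measurable, of x] by (simp add: space_prob_algebra)

lemma emeasure_Q_UNIV [simp]: "emeasure (Q x) UNIV = 1"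
  using prob_space.emeasure_space_1[OF prob_space_Q, of x] by simp

lemma nn_integral_Q_measurable [measurable]:
  assumes "h \<in> borel_measurable borel"
  shows "(\<lambda>x. \<integral>\<^sup>+y. h y \<partial>Q x) \<in> borel_measurable borel"
  using measurable_compose[OF measurable_prob_algebraD[OF Q_measurable]
      nn_integral_measurable_subprob_algebra[OF assms]] .

lemma step_measurable [measurable]:
  assumes [measurable]: "h \<in> borel_measurable borel" "A \<in> sets borel"
  shows "step Q A h \<in> borel_measurable borel"
proof -
  have "(\<lambda>x. \<integral>\<^sup>+y\<in>A. h y \<partial>Q x) \<in> borel_measurable borel"
    by measurable
  then show ?thesis
    by (simp add: step_def [abs_def])
qed

lemma funpow_step_measurable [measurable]:
  assumes [measurable]: "h \<in> borel_measurable borel" "A \<in> sets borel"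
  shows "(step Q A ^^ t) h \<in> borel_measurable borel"
  by (induction t) auto

lemma step_sum:
  assumes [measurable]: "\<And>t. h t \<in> borel_measurable borel" "A \<in> sets borel"
  shows "step Q A (\<lambda>y. \<Sum>t\<in>T. h t y) x = (\<Sum>t\<in>T. step Q A (h t) x)"
  unfolding step_def sum_distrib_right by (rule nn_integral_sum) measurable

lemma step_suminf:
  assumes [measurable]: "\<And>t. h t \<in> borel_measurable borel" "A \<in> sets borel"
  shows "step Q A (\<lambda>y. \<Sum>t. c t * h t y) x = (\<Sum>t. c t * step Q A (h t) x)"
proof -
  have "step Q A (\<lambda>y. \<Sum>t. c t * h t y) x
      = (\<integral>\<^sup>+y. (\<Sum>t. c t * (h t y * indicator A y)) \<partial>Q x)"
    by (simp add: step_def ennreal_suminf_multc[symmetric] mult.assoc)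
  also have "\<dots> = (\<Sum>t. \<integral>\<^sup>+y. c t * (h t y * indicator A y) \<partial>Q x)"
    by (rule nn_integral_suminf) measurable
  also have "\<dots> = (\<Sum>t. c t * step Q A (h t) x)"
    by (simp add: nn_integral_cmult step_def)
  finally show ?thesis .
qed

text \<open>Lets the recursion be written as one integral over the next state, to which monotonicity
  and dominated convergence apply pointwise.\<close>

lemma nn_integral_if_eq_step:
  assumes [measurable]: "g \<in> borel_measurable borel" "h \<in> borel_measurable borel" "S \<in> sets borel"
  shows "(\<integral>\<^sup>+y. (if y \<in> S then g y else h y) \<partial>Q x) = step Q S g x + step Q (- S) h x"
  unfolding step_def
  by (subst nn_integral_add[symmetric]) (auto intro!: nn_integral_cong split: split_indicator)

end

section \<open>Recursion, comparison and limits for hitting values\<close>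

text \<open>The analysis takes place on the state space alone; the process is tied to it by
  \<open>expected_payoff_eq_hit_value\<close>.\<close>

locale discounted_kernel = kernel Q for Q :: "'a::topological_space \<Rightarrow> 'a measure" +
  fixes \<delta> :: "nat \<Rightarrow> real" and f :: "'a \<Rightarrow> real" and B :: real
  assumes f_measurable [measurable]: "f \<in> borel_measurable borel"
    and f_nonneg: "0 \<le> f x"
    and f_le: "f x \<le> B"
    and discount_nonneg: "0 \<le> \<delta> k"
    and discount_antimono: "i \<le> j \<Longrightarrow> \<delta> j \<le> \<delta> i"
    and discount_tendsto: "\<delta> \<longlonglongrightarrow> 0"
begin

abbreviation V :: "'a set \<Rightarrow> nat \<Rightarrow> 'a \<Rightarrow> ennreal" where
  "V \<equiv> hit_value Q \<delta> f"

lemma hit_value_measurable [measurable]: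
  assumes [measurable]: "S \<in> sets borel"
  shows "V S s \<in> borel_measurable borel"
  unfolding hit_value_def [abs_def] by measurable

text \<open>Splitting off the summand \<open>t = 0\<close> leaves the same series with the clock
  advanced by one and an extra outermost killed step, which Tonelli moves outside the sum.\<close>

lemma hit_value_rec:
  assumes [measurable]: "S \<in> sets borel"
  shows "V S s x =
    (\<integral>\<^sup>+y. (if y \<in> S then ennreal (\<delta> (s + 1)) * ennreal (f y) else V S (s + 1) y) \<partial>Q x)"
proof -
  define h where "h = step Q S (\<lambda>y. ennreal (f y))"
  have [measurable]: "h \<in> borel_measurable borel"
    unfolding h_def by measurable
  have "V S s x = ennreal (\<delta> (s + 1)) * h x
      + (\<Sum>t. ennreal (\<delta> (s + 1 + t + 1)) * step Q (- S) ((step Q (- S) ^^ t) h) x)"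
    unfolding hit_value_def h_def[symmetric]
    by (subst suminf_offset[where i = 1]) (auto simp: ac_simps)
  also have "(\<Sum>t. ennreal (\<delta> (s + 1 + t + 1)) * step Q (- S) ((step Q (- S) ^^ t) h) x)
      = step Q (- S) (V S (s + 1)) x"
    unfolding hit_value_def h_def[symmetric]
    by (subst step_suminf[symmetric]) auto
  also have "ennreal (\<delta> (s + 1)) * h x = step Q S (\<lambda>y. ennreal (\<delta> (s + 1)) * ennreal (f y)) x"
    unfolding h_def step_def by (simp add: nn_integral_cmult[symmetric] mult.assoc)
  finally show ?thesis
    by (subst nn_integral_if_eq_step) auto
qed

text \<open>Every discount factor in the series is at most \<open>\<delta> s\<close>, and the
  undiscounted series is the expectation of \<open>f\<close> at the hitting time on the event of a
  hit.\<close>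

lemma hit_value_le:
  assumes [measurable]: "S \<in> sets borel"
  shows "V S s x \<le> ennreal (\<delta> s * B)"
proof -
  define h where "h = step Q S (\<lambda>y. ennreal (f y))"
  have [measurable]: "h \<in> borel_measurable borel"
    unfolding h_def by measurable
  \<comment> \<open>The first \<open>n\<close> summands cover hits within \<open>n\<close> steps.
    One step of the kernel, which has mass 1, leads either to \<open>f \<le> B\<close> or to the sum
    for one step less.\<close>
  have partial: "(\<Sum>t<n. (step Q (- S) ^^ t) h x) \<le> ennreal B" for n x
  proof (induction n arbitrary: x)
    case (Suc n)
    have "(\<Sum>t<Suc n. (step Q (- S) ^^ t) h x)
        = h x + step Q (- S) (\<lambda>y. \<Sum>t<n. (step Q (- S) ^^ t) h y) x"
      by (simp add: sum.lessThan_Suc_shift step_sum del: sum.lessThan_Suc)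
    also have "\<dots> = (\<integral>\<^sup>+y. (if y \<in> S then ennreal (f y)
        else (\<Sum>t<n. (step Q (- S) ^^ t) h y)) \<partial>Q x)"
      unfolding h_def by (subst nn_integral_if_eq_step) auto
    also have "\<dots> \<le> (\<integral>\<^sup>+y. ennreal B \<partial>Q x)"
      by (intro nn_integral_mono) (auto simp: Suc.IH f_le ennreal_leI)
    finally show ?case
      by simp
  qed simp
  have "V S s x \<le> (\<Sum>t. ennreal (\<delta> s) * (step Q (- S) ^^ t) h x)"
    unfolding hit_value_def h_def[symmetric]
    by (intro suminf_le mult_right_mono) (auto intro!: ennreal_leI discount_antimono)
  also have "\<dots> = ennreal (\<delta> s) * (\<Sum>t. (step Q (- S) ^^ t) h x)"
    by (rule ennreal_suminf_cmult)
  also have "\<dots> \<le> ennreal (\<delta> s) * ennreal B"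
    by (intro mult_left_mono suminf_le_const) (auto simp: partial)
  finally show ?thesis
    by (simp add: ennreal_mult' discount_nonneg)
qed

text \<open>The a priori bound on \<open>U\<close> controls its excess over \<open>W\<close>. Each
  pass through the recursion advances the clock in this error term, and the discount sends it to
  0.\<close>

lemma comparison:
  assumes [measurable]: "R \<in> sets borel"
    and [measurable]: "\<And>s. W s \<in> borel_measurable borel"
    and bound: "\<And>s x. U s x \<le> ennreal (\<delta> s * B)"
    and U: "\<And>s x. U s x \<le>
      (\<integral>\<^sup>+y. (if y \<in> R then ennreal (\<delta> (s + 1)) * ennreal (f y) else U (s + 1) y) \<partial>Q x)"
    and W: "\<And>s x. W s x \<ge>
      (\<integral>\<^sup>+y. (if y \<in> R then ennreal (\<delta> (s + 1)) * ennreal (f y) else W (s + 1) y) \<partial>Q x)"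
  shows "U s x \<le> W s x"
proof -
  \<comment> \<open>The error depends only on the final clock time \<open>s + n\<close>, so the
    hypothesis at \<open>s + 1\<close> already supplies the constant \<open>?c\<close>. On
    \<open>R\<close> the integrands agree, and mass 1 lets \<open>?c\<close> pass through the
    integral.\<close>
  have iter: "U s x \<le> W s x + ennreal (\<delta> (s + n) * B)" for n s x
  proof (induction n arbitrary: s x)
    case 0
    show ?case
      using bound[of s x] by (simp add: add_increasing)
  next
    case (Suc n)
    let ?c = "ennreal (\<delta> (s + Suc n) * B)"
    have "U s x \<le> (\<integral>\<^sup>+y. (if y \<in> R then ennreal (\<delta> (s + 1)) * ennreal (f y)
        else U (s + 1) y) \<partial>Q x)"
      by (rule U)
    also have "\<dots> \<le> (\<integral>\<^sup>+y. (if y \<in> R then ennreal (\<delta> (s + 1)) * ennreal (f y)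
        else W (s + 1) y) + ?c \<partial>Q x)"
      using Suc.IH[of "s + 1"] by (intro nn_integral_mono) (auto simp: add_increasing2)
    also have "\<dots> = (\<integral>\<^sup>+y. (if y \<in> R then ennreal (\<delta> (s + 1)) * ennreal (f y)
        else W (s + 1) y) \<partial>Q x) + ?c"
      by (subst nn_integral_add) auto
    also have "\<dots> \<le> W s x + ?c"
      by (intro add_right_mono W)
    finally show ?case .
  qed
  have "(\<lambda>n. \<delta> (s + n) * B) \<longlonglongrightarrow> 0 * B"
    using LIMSEQ_ignore_initial_segment[OF discount_tendsto, of s]
    by (intro tendsto_mult) (auto simp: add.commute)
  then have "(\<lambda>n. W s x + ennreal (\<delta> (s + n) * B)) \<longlonglongrightarrow> W s x + ennreal 0"
    by (intro tendsto_add tendsto_ennrealI) auto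
  then show ?thesis
    using iter[of s x] by (intro LIMSEQ_le_const) auto
qed

text \<open>Where \<open>R\<close> would stop but \<open>S\<close> would not, nothing happens as
  \<open>R \<subseteq> S\<close>; on \<open>S - R\<close> replacing the stopped payoff by continued
  waiting does not lower the value. So \<open>V S\<close> is a subsolution for \<open>R\<close>,
  while \<open>V R\<close> is an exact solution.\<close>

lemma hit_value_mono:
  assumes superadd: "\<And>i j. \<delta> i * \<delta> j \<le> \<delta> (i + j)"
    and [measurable]: "S \<in> sets borel" "R \<in> sets borel"
    and "R \<subseteq> S"
    and wait: "\<And>x. x \<in> S - R \<Longrightarrow> ennreal (f x) \<le> V S 0 x"
  shows "V S s x \<le> V R s x"
proof (rule comparison[where R = R])
  fix s x
  \<comment> \<open>Summand by summand, \<open>superadd\<close> with \<open>s\<close> and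
    \<open>t + 1\<close>: discounting a fresh start by \<open>\<delta> s\<close> undervalues waiting
    at clock \<open>s\<close>. This carries \<open>wait\<close> from clock 0 to every clock
    time.\<close>
  have delayed: "ennreal (\<delta> s) * V S 0 y \<le> V S s y" for s y
  proof -
    have "ennreal (\<delta> s) * ennreal (\<delta> (0 + t + 1)) \<le> ennreal (\<delta> (s + t + 1))" for t
      using superadd[of s "t + 1"]
      by (simp add: ennreal_mult'[symmetric] discount_nonneg ennreal_leI add.assoc)
    then show ?thesis
      unfolding hit_value_def ennreal_suminf_cmult[symmetric] mult.assoc[symmetric]
      by (intro suminf_le mult_right_mono) auto
  qed
  have "ennreal (\<delta> (s + 1)) * ennreal (f y) \<le> V S (s + 1) y" if "y \<in> S - R" for y
    using mult_left_mono[OF wait[OF that], of "ennreal (\<delta> (s + 1))"] delayed[of "s + 1" y]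
    by (simp add: order_trans)
  then show "V S s x \<le>
      (\<integral>\<^sup>+y. (if y \<in> R then ennreal (\<delta> (s + 1)) * ennreal (f y) else V S (s + 1) y) \<partial>Q x)"
    using \<open>R \<subseteq> S\<close> by (subst hit_value_rec) (auto intro!: nn_integral_mono)
next
  fix s x
  show "(\<integral>\<^sup>+y. (if y \<in> R then ennreal (\<delta> (s + 1)) * ennreal (f y) else V R (s + 1) y) \<partial>Q x)
      \<le> V R s x"
    by (subst (2) hit_value_rec) auto
qed (auto intro: hit_value_le)

text \<open>Passing to the limit in the recursion shows that the supremum of the values solves the
  recursion for the intersection; bounded solutions of it are unique by
  \<open>comparison\<close>.\<close>

lemma hit_value_INT:
  assumes [measurable]: "\<And>n. S n \<in> sets borel"
    and "decseq S"
    and mono: "\<And>s x. incseq (\<lambda>n. V (S n) s x)"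
  shows "V (\<Inter>n. S n) s x = (SUP n. V (S n) s x)"
proof -
  let ?R = "\<Inter>n. S n"
  define W where "W s x = (SUP n. V (S n) s x)" for s x
  have R_sets [measurable]: "?R \<in> sets borel"
    by measurable
  have W_measurable [measurable]: "W s \<in> borel_measurable borel" for s
    unfolding W_def [abs_def] by measurable
  have bound: "W s x \<le> ennreal (\<delta> s * B)" for s x
    unfolding W_def by (auto intro!: SUP_least hit_value_le)
  have lim: "(\<lambda>n. V (S n) s x) \<longlonglongrightarrow> W s x" for s x
    unfolding W_def by (rule LIMSEQ_SUP[OF mono])
  have rec: "W s x =
      (\<integral>\<^sup>+y. (if y \<in> ?R then ennreal (\<delta> (s + 1)) * ennreal (f y) else W (s + 1) y) \<partial>Q x)"
    for s x
  proof -
    let ?g = "\<lambda>n y. if y \<in> S n then ennreal (\<delta> (s + 1)) * ennreal (f y) else V (S n) (s + 1) y"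
    let ?h = "\<lambda>y. if y \<in> ?R then ennreal (\<delta> (s + 1)) * ennreal (f y) else W (s + 1) y"
    \<comment> \<open>Since \<open>S\<close> is decreasing, a point either lies in all
      \<open>S n\<close> or has left for good from some \<open>m\<close> on, so the branch taken is
      eventually constant.\<close>
    have conv: "(\<lambda>n. ?g n y) \<longlonglongrightarrow> ?h y" for y
    proof (cases "y \<in> ?R")
      case False
      then obtain m where "y \<notin> S m"
        by auto
      then have "y \<notin> S n" if "m \<le> n" for n
        using decseqD[OF \<open>decseq S\<close> that] by auto
      then have "\<forall>\<^sub>F n in sequentially. V (S n) (s + 1) y = ?g n y"
        by (auto simp: eventually_sequentially)
      then show ?thesis
        using False lim[of "s + 1" y] by (auto intro: Lim_transform_eventually)
    qed auto
    \<comment> \<open>One constant bounds both branches; it is the integrable majorant for dominated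
      convergence.\<close>
    have le: "?g n y \<le> ennreal (\<delta> (s + 1) * B)" for n y
      using mult_left_mono[OF f_le[of y] discount_nonneg[of "s + 1"]]
      by (auto simp: hit_value_le ennreal_mult'[symmetric] discount_nonneg ennreal_leI)
    have "(\<lambda>n. \<integral>\<^sup>+y. ?g n y \<partial>Q x) \<longlonglongrightarrow> (\<integral>\<^sup>+y. ?h y \<partial>Q x)"
    proof (rule nn_integral_dominated_convergence[where w = "\<lambda>_. ennreal (\<delta> (s + 1) * B)"])
      show "AE y in Q x. ?g n y \<le> ennreal (\<delta> (s + 1) * B)" for n
        by (intro AE_I2 le)
      show "AE y in Q x. (\<lambda>n. ?g n y) \<longlonglongrightarrow> ?h y"
        by (intro AE_I2 conv)
    qed auto
    then have "(\<lambda>n. V (S n) s x) \<longlonglongrightarrow> (\<integral>\<^sup>+y. ?h y \<partial>Q x)"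
      by (subst hit_value_rec) auto
    then show ?thesis
      using lim[of s x] LIMSEQ_unique by blast
  qed
  \<comment> \<open>Both functions are exact solutions below \<open>\<delta> s * B\<close>, so
    \<open>comparison\<close> applies in either direction.\<close>
  have "V ?R s x \<le> W s x"
    by (rule comparison[where R = ?R and U = "V ?R" and W = W, OF R_sets W_measurable
          hit_value_le[OF R_sets] eq_refl[OF hit_value_rec[OF R_sets]] eq_refl[OF rec[symmetric]]])
  moreover have "W s x \<le> V ?R s x"
    by (rule comparison[where R = ?R and U = W and W = "V ?R", OF R_sets
          hit_value_measurable[OF R_sets] bound eq_refl[OF rec]
          eq_refl[OF hit_value_rec[OF R_sets, symmetric]]])
  ultimately show ?thesis
    unfolding W_def by (rule antisym)
qed

end

section \<open>The Markov property in integrated form\<close>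

lemma natural_filtration_measurable:
  assumes "s \<le> t"
  shows "X s \<in> natural_filtration M X t \<rightarrow>\<^sub>M borel"
proof (rule measurableI)
  fix A :: "'b set"
  assume "A \<in> sets borel"
  then show "X s -` A \<inter> space (natural_filtration M X t) \<in> sets (natural_filtration M X t)"
    using assms unfolding natural_filtration_def
    by (subst sets_measure_of) (auto simp: space_measure_of_conv intro!: sigma_sets.Basic)
qed simp

lemma subalgebra_natural_filtration:
  assumes "\<And>s. X s \<in> M \<rightarrow>\<^sub>M borel"
  shows "subalgebra M (natural_filtration M X t)"
proof -
  have "{X s -` A \<inter> space M | s A. s \<le> t \<and> A \<in> sets borel} \<subseteq> sets M"
    using assms by (auto intro: measurable_sets)
  moreover have "{X s -` A \<inter> space M | s A. s \<le> t \<and> A \<in> sets borel} \<subseteq> Pow (space M)"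
    by auto
  ultimately show ?thesis
    by (simp add: subalgebra_def natural_filtration_def space_measure_of_conv
        sets.sigma_sets_subset)
qed

text \<open>The definition gives the Markov property for indicators as a conditional expectation.
  Integrating over \<open>G\<close> removes the exceptional null sets, and induction over
  nonnegative Borel functions extends it to \<open>g\<close>.\<close>

lemma markov_process_nn_integral:
  assumes markov: "markov_process Q M X"
    and G: "G \<in> sets (natural_filtration M X t)"
    and [measurable]: "g \<in> borel_measurable borel"
  shows "(\<integral>\<^sup>+\<omega>\<in>G. g (X (Suc t) \<omega>) \<partial>M) = (\<integral>\<^sup>+\<omega>\<in>G. (\<integral>\<^sup>+y. g y \<partial>Q (X t \<omega>)) \<partial>M)"
proof -
  interpret prob_space M
    using markov by (simp add: markov_process_def)
  interpret kernel Q
    using markov by unfold_locales (simp add: markov_process_def)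
  have X [measurable]: "X s \<in> M \<rightarrow>\<^sub>M borel" for s
    using markov by (simp add: markov_process_def)
  let ?F = "natural_filtration M X t"
  have sub: "subalgebra M ?F"
    by (rule subalgebra_natural_filtration) (rule X)
  interpret finite_measure_subalgebra M ?F
    by unfold_locales (rule sub)
  have [measurable]: "G \<in> sets M"
    using G sub by (auto simp: subalgebra_def)
  show ?thesis
    using assms(3)
  proof (induction g rule: borel_measurable_induct)
    case (cong g h)
    then show ?case
      by simp
  next
    case (set A)
    then have [measurable]: "A \<in> sets borel"
      by simp
    have meas: "(\<lambda>\<omega>. measure (Q (X t \<omega>)) A) \<in> borel_measurable M"
    proof -
      have "(\<lambda>x. measure (Q x) A) \<in> borel_measurable borel"
        using measurable_compose[OF measurable_prob_algebraD[OF Q_measurable]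
            measurable_measure_subprob_algebra[OF \<open>A \<in> sets borel\<close>]] .
      then show ?thesis
        by measurable
    qed
    have le1: "measure (Q (X t \<omega>)) A \<le> 1" for \<omega>
      by (rule prob_space.prob_le_1[OF prob_space_Q])
    have int: "integrable M (\<lambda>\<omega>. indicator A (X (Suc t) \<omega>) :: real)"
      by (rule integrable_const_bound[where B = 1]) auto
    \<comment> \<open>The defining property of conditional expectation yields an identity of real
      integrals; boundedness by 1 then permits its translation into nonnegative integrals.\<close>
    have "(\<integral>\<omega>\<in>G. indicator A (X (Suc t) \<omega>) \<partial>M)
        = (\<integral>\<omega>\<in>G. real_cond_exp M ?F (\<lambda>\<omega>. indicator A (X (Suc t) \<omega>)) \<omega> \<partial>M)"
      by (rule real_cond_exp_intA[OF int G])
    also have "\<dots> = (\<integral>\<omega>\<in>G. measure (Q (X t \<omega>)) A \<partial>M)"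
      unfolding set_lebesgue_integral_def
    proof (rule integral_cong_AE)
      have "AE \<omega> in M. real_cond_exp M ?F (\<lambda>\<omega>. indicator A (X (Suc t) \<omega>)) \<omega>
          = measure (Q (X t \<omega>)) A"
        using markov by (simp add: markov_process_def)
      then show "AE \<omega> in M. indicator G \<omega> *\<^sub>R
            real_cond_exp M ?F (\<lambda>\<omega>. indicator A (X (Suc t) \<omega>)) \<omega>
          = indicator G \<omega> *\<^sub>R measure (Q (X t \<omega>)) A"
        by eventually_elim simp
    qed (use meas in measurable)
    finally have eq: "(\<integral>\<omega>. indicator G \<omega> * indicator A (X (Suc t) \<omega>) \<partial>M)
        = (\<integral>\<omega>. indicator G \<omega> * measure (Q (X t \<omega>)) A \<partial>M)"
      by (simp add: set_lebesgue_integral_def)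
    have "(\<integral>\<^sup>+\<omega>\<in>G. indicator A (X (Suc t) \<omega>) \<partial>M)
        = (\<integral>\<^sup>+\<omega>. ennreal (indicator G \<omega> * indicator A (X (Suc t) \<omega>)) \<partial>M)"
      by (auto intro!: nn_integral_cong split: split_indicator)
    also have "\<dots> = ennreal (\<integral>\<omega>. indicator G \<omega> * indicator A (X (Suc t) \<omega>) \<partial>M)"
      by (intro nn_integral_eq_integral integrable_const_bound[where B = 1])
        (auto split: split_indicator)
    also have "\<dots> = ennreal (\<integral>\<omega>. indicator G \<omega> * measure (Q (X t \<omega>)) A \<partial>M)"
      by (simp only: eq)
    also have "\<dots> = (\<integral>\<^sup>+\<omega>. ennreal (indicator G \<omega> * measure (Q (X t \<omega>)) A) \<partial>M)"
      using meas le1 by (intro nn_integral_eq_integral[symmetric]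
          integrable_const_bound[where B = 1]) (auto split: split_indicator)
    also have "\<dots> = (\<integral>\<^sup>+\<omega>\<in>G. (\<integral>\<^sup>+y. indicator A y \<partial>Q (X t \<omega>)) \<partial>M)"
      by (auto intro!: nn_integral_cong split: split_indicator
          simp: finite_measure.emeasure_eq_measure[OF prob_space.finite_measure[OF prob_space_Q]])
    finally show ?case .
  next
    case (mult u c)
    then have [measurable]: "u \<in> borel_measurable borel"
      by simp
    show ?case
      using mult.IH by (simp add: nn_integral_cmult mult.assoc)
  next
    case (add u v)
    then have [measurable]: "u \<in> borel_measurable borel" "v \<in> borel_measurable borel"
      by simp_all
    show ?case
      using add.IH by (simp add: nn_integral_add distrib_right)
  next
    case (seq U)
    then have [measurable]: "U i \<in> borel_measurable borel" for i
      by simp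
    have mono: "incseq (\<lambda>i \<omega>. U i (X (Suc t) \<omega>) * indicator G \<omega>)"
      using seq(3) by (auto simp: incseq_def le_fun_def intro!: mult_right_mono)
    have Qmono: "incseq (\<lambda>i \<omega>. (\<integral>\<^sup>+y. U i y \<partial>Q (X t \<omega>)) * indicator G \<omega>)"
      using seq(3) by (auto simp: incseq_def le_fun_def intro!: mult_right_mono nn_integral_mono)
    have "(\<integral>\<^sup>+\<omega>\<in>G. (SUP i. U i) (X (Suc t) \<omega>) \<partial>M) = (SUP i. \<integral>\<^sup>+\<omega>\<in>G. U i (X (Suc t) \<omega>) \<partial>M)"
      by (subst nn_integral_monotone_convergence_SUP[symmetric])
        (auto simp: image_comp SUP_mult_right_ennreal intro!: mono)
    also have "\<dots> = (SUP i. \<integral>\<^sup>+\<omega>\<in>G. (\<integral>\<^sup>+y. U i y \<partial>Q (X t \<omega>)) \<partial>M)"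
      by (simp add: seq)
    also have "\<dots> = (\<integral>\<^sup>+\<omega>. (SUP i. (\<integral>\<^sup>+y. U i y \<partial>Q (X t \<omega>)) * indicator G \<omega>) \<partial>M)"
      by (subst nn_integral_monotone_convergence_SUP[symmetric]) (auto intro!: Qmono)
    also have "\<dots> = (\<integral>\<^sup>+\<omega>\<in>G. (\<integral>\<^sup>+y. (SUP i. U i) y \<partial>Q (X t \<omega>)) \<partial>M)"
      using seq(3)
      by (auto intro!: nn_integral_cong simp: image_comp SUP_mult_right_ennreal[symmetric]
          nn_integral_monotone_convergence_SUP)
    finally show ?case .
  qed
qed

text \<open>The last transition is averaged out first, given the past that decides whether
  \<open>S\<close> was avoided. Each round absorbs a kernel step into \<open>g\<close>, so the
  induction needs \<open>g\<close> arbitrary.\<close>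

lemma markov_process_avoid:
  assumes markov: "markov_process Q M X"
    and start: "AE \<omega> in M. X 0 \<omega> = x"
    and [measurable]: "S \<in> sets borel" "g \<in> borel_measurable borel"
  shows "(\<integral>\<^sup>+\<omega>. g (X (Suc t) \<omega>) * indicator {\<omega>. \<forall>i\<in>{1..t}. X i \<omega> \<notin> S} \<omega> \<partial>M)
    = (step Q (- S) ^^ t) (\<lambda>z. \<integral>\<^sup>+y. g y \<partial>Q z) x"
  using assms(4)
proof (induction t arbitrary: g)
  case 0
  interpret prob_space M
    using markov by (simp add: markov_process_def)
  interpret kernel Q
    using markov by unfold_locales (simp add: markov_process_def)
  note [measurable] = 0
  have X [measurable]: "X s \<in> M \<rightarrow>\<^sub>M borel" for s
    using markov by (simp add: markov_process_def)
  \<comment> \<open>For \<open>t = 0\<close> the range \<open>{1..0}\<close> is empty and the event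
    is the whole space.\<close>
  have "space M \<in> sets (natural_filtration M X 0)"
    using sets.top[of "natural_filtration M X 0"]
    by (simp add: natural_filtration_def space_measure_of_conv)
  from markov_process_nn_integral[OF markov this 0]
  have "(\<integral>\<^sup>+\<omega>. g (X (Suc 0) \<omega>) \<partial>M) = (\<integral>\<^sup>+\<omega>. (\<integral>\<^sup>+y. g y \<partial>Q (X 0 \<omega>)) \<partial>M)"
    by simp
  also have "\<dots> = (\<integral>\<^sup>+\<omega>. (\<integral>\<^sup>+y. g y \<partial>Q x) \<partial>M)"
    using start by (intro nn_integral_cong_AE) auto
  finally show ?case
    by (simp add: emeasure_space_1)
next
  case (Suc t)
  interpret kernel Q
    using markov by unfold_locales (simp add: markov_process_def)
  note [measurable] = Suc.prems
  let ?F = "natural_filtration M X (Suc t)"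
  define G where "G = {\<omega>\<in>space M. \<forall>i\<in>{1..Suc t}. X i \<omega> \<notin> S}"
  have "{\<omega>\<in>space ?F. \<forall>i\<in>{1..Suc t}. X i \<omega> \<notin> S} \<in> sets ?F"
  proof (rule sets.sets_Collect_finite_All)
    fix i assume "i \<in> {1..Suc t}"
    then have [measurable]: "X i \<in> ?F \<rightarrow>\<^sub>M borel"
      by (intro natural_filtration_measurable) auto
    show "{\<omega>\<in>space ?F. X i \<omega> \<notin> S} \<in> sets ?F"
      by measurable
  qed simp
  then have G: "G \<in> sets ?F"
    by (simp add: G_def natural_filtration_def space_measure_of_conv)
  have "(\<integral>\<^sup>+\<omega>. g (X (Suc (Suc t)) \<omega>) * indicator {\<omega>. \<forall>i\<in>{1..Suc t}. X i \<omega> \<notin> S} \<omega> \<partial>M)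
      = (\<integral>\<^sup>+\<omega>\<in>G. g (X (Suc (Suc t)) \<omega>) \<partial>M)"
    by (auto intro!: nn_integral_cong simp: G_def split: split_indicator)
  also have "\<dots> = (\<integral>\<^sup>+\<omega>\<in>G. (\<integral>\<^sup>+y. g y \<partial>Q (X (Suc t) \<omega>)) \<partial>M)"
    by (rule markov_process_nn_integral[OF markov G Suc.prems])
  \<comment> \<open>The condition at time \<open>Suc t\<close> moves from the event into the
    integrand, leaving an event about times up to \<open>t\<close> as the induction hypothesis
    requires.\<close>
  also have "\<dots> = (\<integral>\<^sup>+\<omega>. (\<lambda>z. (\<integral>\<^sup>+y. g y \<partial>Q z) * indicator (- S) z) (X (Suc t) \<omega>)
      * indicator {\<omega>. \<forall>i\<in>{1..t}. X i \<omega> \<notin> S} \<omega> \<partial>M)"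
    by (auto intro!: nn_integral_cong simp: G_def atLeastAtMostSuc_conv split: split_indicator)
  also have "\<dots> = (step Q (- S) ^^ t)
      (\<lambda>z. \<integral>\<^sup>+y. (\<integral>\<^sup>+y. g y \<partial>Q y) * indicator (- S) y \<partial>Q z) x"
    by (rule Suc.IH) measurable
  also have "\<dots> = (step Q (- S) ^^ t) (step Q (- S) (\<lambda>z. \<integral>\<^sup>+y. g y \<partial>Q z)) x"
    by (simp add: step_def [abs_def])
  finally show ?case
    by (simp add: funpow_swap1)
qed

section \<open>Expected payoffs as hitting values\<close>

text \<open>Only the summand of the first visit can be nonzero. The identity holds path by path, so
  measurability of the payoff can later be read off from the series.\<close>

lemma payoff_eq_suminf:
  "ennreal (case return_time X x S \<omega> of enat t \<Rightarrow> \<delta> t * f (X x t \<omega>) | \<infinity> \<Rightarrow> 0) =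
    (\<Sum>t. ennreal (\<delta> (Suc t) * f (X x (Suc t) \<omega>)) * indicator S (X x (Suc t) \<omega>)
        * indicator {\<omega>. \<forall>i\<in>{1..t}. X x i \<omega> \<notin> S} \<omega>)"
proof (cases "\<exists>t\<ge>1. X x t \<omega> \<in> S")
  case False
  then have "return_time X x S \<omega> = \<infinity>"
    by (auto simp: return_time_def Inf_enat_def)
  moreover have "X x (Suc t) \<omega> \<notin> S" for t
    using False by auto
  ultimately show ?thesis
    by simp
next
  case True
  define a where "a t = ennreal (\<delta> (Suc t) * f (X x (Suc t) \<omega>)) * indicator S (X x (Suc t) \<omega>)
        * indicator {\<omega>. \<forall>i\<in>{1..t}. X x i \<omega> \<notin> S} \<omega>" for t
  define T where "T = (LEAST t. 1 \<le> t \<and> X x t \<omega> \<in> S)"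
  have T: "1 \<le> T" "X x T \<omega> \<in> S"
    using LeastI_ex[of "\<lambda>t. 1 \<le> t \<and> X x t \<omega> \<in> S"] True by (auto simp: T_def)
  have T_le: "T \<le> t" if "1 \<le> t" "X x t \<omega> \<in> S" for t
    unfolding T_def using that by (intro Least_le) auto
  have "return_time X x S \<omega> = enat T"
    unfolding return_time_def
    using T T_le by (intro antisym Inf_lower Inf_greatest) auto
  moreover obtain k where k: "T = Suc k"
    using T(1) by (cases T) auto
  \<comment> \<open>For \<open>t < k\<close> the time \<open>Suc t\<close> precedes the first visit
    \<open>T = Suc k\<close>; for \<open>t > k\<close> the visit at \<open>T\<close> lies in
    \<open>{1..t}\<close>.\<close>
  have "\<not> (\<forall>i\<in>{1..t}. X x i \<omega> \<notin> S) \<or> X x (Suc t) \<omega> \<notin> S" if "t \<noteq> k" for t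
    using T T_le[of "Suc t"] that by (cases "t < k") (auto simp: k)
  then have "a t = 0" if "t \<noteq> k" for t
    using that by (auto simp: a_def split: split_indicator)
  then have "(\<Sum>t. a t) = a k"
    using suminf_finite[of "{k}" a] by simp
  moreover have "X x i \<omega> \<notin> S" if "1 \<le> i" "i \<le> k" for i
    using T_le[of i] that k by auto
  ultimately show ?thesis
    using T k by (simp add: a_def)
qed

text \<open>The pathwise series is integrated term by term, each term being given by
  \<open>markov_process_avoid\<close>. Hence the payoff depends on the process only through
  \<open>Q\<close> and \<open>x\<close>, although each \<open>x\<close> has its own probability
  space.\<close>

lemma (in discounted_kernel) expected_payoff_eq_hit_value:
  assumes family: "markov_family Q M X"
    and [measurable]: "S \<in> sets borel"
  shows "ennreal (expected_payoff M X \<delta> f x (return_time X x S)) = V S 0 x"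
proof -
  have markov: "markov_process Q (M x) (X x)" and start: "AE \<omega> in M x. X x 0 \<omega> = x"
    using family by (auto simp: markov_family_def)
  interpret P: prob_space "M x"
    using markov by (simp add: markov_process_def)
  have [measurable]: "X x s \<in> M x \<rightarrow>\<^sub>M borel" for s
    using markov by (simp add: markov_process_def)
  define p where
    "p \<omega> = (case return_time X x S \<omega> of enat t \<Rightarrow> \<delta> t * f (X x t \<omega>) | \<infinity> \<Rightarrow> 0)" for \<omega>
  define a where "a t \<omega> = ennreal (\<delta> (Suc t) * f (X x (Suc t) \<omega>)) * indicator S (X x (Suc t) \<omega>)
        * indicator {\<omega>. \<forall>i\<in>{1..t}. X x i \<omega> \<notin> S} \<omega>" for t \<omega>
  have a [measurable]: "a t \<in> borel_measurable (M x)" for t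
    unfolding a_def [abs_def] by measurable
  have p_a: "ennreal (p \<omega>) = (\<Sum>t. a t \<omega>)" for \<omega>
    unfolding p_def a_def by (rule payoff_eq_suminf)
  have p_nonneg: "0 \<le> p \<omega>" for \<omega>
    by (auto simp: p_def discount_nonneg f_nonneg split: enat.split)
  have B: "0 \<le> B"
    using f_nonneg f_le order_trans by blast
  have p_le: "p \<omega> \<le> \<delta> 0 * B" for \<omega>
    by (auto simp: p_def B discount_nonneg f_nonneg f_le discount_antimono
        intro!: mult_mono split: enat.split)
  have "p = (\<lambda>\<omega>. enn2real (\<Sum>t. a t \<omega>))"
    using p_nonneg by (auto simp: p_a[symmetric])
  then have p [measurable]: "p \<in> borel_measurable (M x)"
    by simp
  have summand: "(\<integral>\<^sup>+\<omega>. a t \<omega> \<partial>M x)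
      = ennreal (\<delta> (Suc t)) * (step Q (- S) ^^ t) (step Q S (\<lambda>y. ennreal (f y))) x" for t
  proof -
    have "(\<integral>\<^sup>+\<omega>. a t \<omega> \<partial>M x) = (\<integral>\<^sup>+\<omega>. ennreal (\<delta> (Suc t)) *
        ((\<lambda>y. ennreal (f y) * indicator S y) (X x (Suc t) \<omega>)
          * indicator {\<omega>. \<forall>i\<in>{1..t}. X x i \<omega> \<notin> S} \<omega>) \<partial>M x)"
      by (auto intro!: nn_integral_cong simp: a_def ennreal_mult' discount_nonneg mult.assoc)
    also have "\<dots> = ennreal (\<delta> (Suc t)) *
        (\<integral>\<^sup>+\<omega>. (\<lambda>y. ennreal (f y) * indicator S y) (X x (Suc t) \<omega>)
          * indicator {\<omega>. \<forall>i\<in>{1..t}. X x i \<omega> \<notin> S} \<omega> \<partial>M x)"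
      by (rule nn_integral_cmult) measurable
    also have "\<dots> = ennreal (\<delta> (Suc t)) *
        (step Q (- S) ^^ t) (\<lambda>z. \<integral>\<^sup>+y. ennreal (f y) * indicator S y \<partial>Q z) x"
      by (subst markov_process_avoid[OF markov start]) auto
    finally show ?thesis
      by (simp add: step_def [abs_def])
  qed
  \<comment> \<open>Without integrability the real integral would take its default value 0.\<close>
  have "integrable (M x) p"
    using p_nonneg p_le by (intro P.integrable_const_bound[where B = "\<delta> 0 * B"]) auto
  then have "ennreal (\<integral>\<omega>. p \<omega> \<partial>M x) = (\<integral>\<^sup>+\<omega>. (\<Sum>t. a t \<omega>) \<partial>M x)"
    using p_nonneg by (subst nn_integral_eq_integral[symmetric]) (auto simp: p_a)
  also have "\<dots> = (\<Sum>t. \<integral>\<^sup>+\<omega>. a t \<omega> \<partial>M x)"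
    by (rule nn_integral_suminf) (rule a)
  also have "\<dots> = (\<Sum>t. ennreal (\<delta> (Suc t)) *
      (step Q (- S) ^^ t) (step Q S (\<lambda>y. ennreal (f y))) x)"
    by (intro suminf_cong summand)
  finally show ?thesis
    by (simp add: expected_payoff_def p_def hit_value_def)
qed

section \<open>The iterates of \<open>Theta\<close> and their intersection\<close>

theorem corollary3p1:
  fixes Q :: "'a::polish_space \<Rightarrow> 'a measure"
    and M :: "'a \<Rightarrow> 'w measure"
    and X :: "'a \<Rightarrow> nat \<Rightarrow> 'w \<Rightarrow> 'a"
    and f :: "'a \<Rightarrow> real"
    and \<delta> :: "nat \<Rightarrow> real"
  assumes "markov_family Q M X"
    and "f \<in> borel_measurable borel"
    and "\<And>x. 0 \<le> f x"
    and "bounded (range f)"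
    and "\<And>k. \<delta> k \<in> {0..1}"
    and "\<And>i j. i < j \<Longrightarrow> \<delta> j < \<delta> i"
    and "\<delta> 0 = 1"
    and "\<delta> \<longlonglongrightarrow> 0"
    and "\<And>i j. \<delta> i * \<delta> j \<le> \<delta> (i + j)"
  shows "equilibrium M X \<delta> f (\<Inter>n\<in>{1..}. (Theta M X \<delta> f ^^ n) UNIV)"
proof -
  obtain B where B: "\<And>x. \<bar>f x\<bar> \<le> B"
    using assms(4) by (auto simp: bounded_iff)
  have "\<delta> j \<le> \<delta> i" if "i \<le> j" for i j
    using assms(6)[of i j] that by (cases "i = j") auto
  moreover have "Q \<in> borel \<rightarrow>\<^sub>M prob_algebra borel"
    using assms(1) by (simp add: markov_family_def markov_process_def)
  ultimately interpret discounted_kernel Q \<delta> f B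
    using assms(2,3,5,8) B by unfold_locales (auto intro: order_trans[OF abs_ge_self])
  let ?\<Theta> = "Theta M X \<delta> f"
  \<comment> \<open>As \<open>f\<close> is nonnegative, the real inequality defining
    \<open>Theta\<close> may be read in \<open>ennreal\<close>.\<close>
  have Theta: "?\<Theta> S = {x. V S 0 x \<le> ennreal (f x)}" if "S \<in> sets borel" for S
    using assms(3) expected_payoff_eq_hit_value[OF assms(1) that]
    by (auto simp: Theta_def simp flip: ennreal_le_iff)
  have Theta_sets: "?\<Theta> S \<in> sets borel" if [measurable]: "S \<in> sets borel" for S
  proof -
    have "{x \<in> space borel. V S 0 x \<le> ennreal (f x)} \<in> sets borel"
      by measurable
    then show ?thesis
      by (simp add: Theta[OF that])
  qed
  define S where "S n = (?\<Theta> ^^ n) UNIV" for n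
  have S_Suc: "S (Suc n) = ?\<Theta> (S n)" for n
    by (simp add: S_def)
  have S_sets [measurable]: "S n \<in> sets borel" for n
    by (induction n) (auto simp: S_def intro: Theta_sets)
  \<comment> \<open>Points removed by \<open>Theta\<close> are exactly those where waiting is
    strictly better. The inclusion stays a premise because the induction for \<open>subset\<close>
    uses this fact before inclusions are known for all \<open>n\<close>.\<close>
  have mono: "V (S n) s x \<le> V (S (Suc n)) s x" if "S (Suc n) \<subseteq> S n" for n s x
  proof (rule hit_value_mono[OF assms(9) S_sets S_sets that])
    show "ennreal (f y) \<le> V (S n) 0 y" if "y \<in> S n - S (Suc n)" for y
      using that by (simp add: S_Suc Theta[OF S_sets] not_le less_imp_le)
  qed
  \<comment> \<open>Values grow along the iterates, so stopping against the later, larger value also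
    means stopping against the earlier one.\<close>
  have subset: "S (Suc n) \<subseteq> S n" for n
  proof (induction n)
    case 0
    show ?case
      by (simp add: S_def)
  next
    case (Suc n)
    show ?case
    proof
      fix y assume "y \<in> S (Suc (Suc n))"
      then have "V (S (Suc n)) 0 y \<le> ennreal (f y)"
        unfolding S_Suc[of "Suc n"] by (simp add: Theta)
      then have "V (S n) 0 y \<le> ennreal (f y)"
        using mono[OF Suc.IH, of 0 y] by (rule order_trans[rotated])
      then show "y \<in> S (Suc n)"
        by (simp add: S_Suc Theta)
    qed
  qed
  have Inter: "(\<Inter>n\<in>{1..}. S n) = (\<Inter>n. S (Suc n))" "(\<Inter>n. S n) = (\<Inter>n. S (Suc n))"
  proof -
    show "(\<Inter>n\<in>{1..}. S n) = (\<Inter>n. S (Suc n))"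
      by (auto dest: Suc_le_D)
    show "(\<Inter>n. S n) = (\<Inter>n. S (Suc n))"
      using subset by blast
  qed
  have limit: "V (\<Inter>n. S n) 0 x = (SUP n. V (S n) 0 x)" for x
  proof (rule hit_value_INT)
    show "decseq S"
      by (rule decseq_SucI) (rule subset)
    show "incseq (\<lambda>n. V (S n) s x)" for s x
      by (rule incseq_SucI) (rule mono[OF subset])
  qed (rule S_sets)
  have Int_sets: "(\<Inter>n. S n) \<in> sets borel"
    by measurable
  \<comment> \<open>By \<open>limit\<close>, a supremum is at most \<open>f x\<close> iff every
    \<open>V (S n) 0 x\<close> is, that is, iff \<open>x\<close> lies in every
    \<open>S (Suc n)\<close>.\<close>
  have "?\<Theta> (\<Inter>n. S n) = (\<Inter>n. S (Suc n))"
    unfolding Theta[OF Int_sets] S_Suc Theta[OF S_sets] limit by (auto simp: SUP_le_iff)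
  then show ?thesis
    using Int_sets unfolding equilibrium_def S_def[symmetric] Inter by simp
qed

end
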